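(* Every convex subset $X$ of the plane $\mathbb{R}^2$ is compactly convex.
   Context: For a topological space $X$, $\exp(X)$ denotes the hyperspace of all non-empty compact subsets of $X$, endowed with the Vietoris topology, whose sub-base consists of the sets $\{K\in\exp(X):K\subset U\}$ and $\{K\in\exp(X):K\cap U\neq\emptyset\}$, where $U$ runs over the open subsets of $X$. For points $x,y$ of a real linear space, $[x,y]=\{(1-t)x+ty:t\in[0,1]\}$. A convex subset $X$ of a linear topological space (with the subspace topology) is called compactly convex if there is a continuous map $\Phi:X\to\exp(X)$ such that $[x,y]\subset\Phi(x)\cup\Phi(y)$ for all $x,y\in X$. *)

theory Defs
  imports "HOL-Analysis.Analysis"
begin

definition exp_carrier :: "'a topology \<Rightarrow> 'a set set"
  where "exp_carrier T = {K. compactin T K \<and> K \<noteq> {}}"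

definition vietoris_subbase :: "'a topology \<Rightarrow> 'a set set set"
  where "vietoris_subbase T =
    {{K \<in> exp_carrier T. K \<subseteq> U} | U. openin T U} \<union>
    {{K \<in> exp_carrier T. K \<inter> U \<noteq> {}} | U. openin T U}"

definition vietoris :: "'a topology \<Rightarrow> 'a set topology"
  where "vietoris T = topology_generated_by (vietoris_subbase T)"

lemma topspace_vietoris: "topspace (vietoris T) = exp_carrier T"
proof -
  have "exp_carrier T = {K \<in> exp_carrier T. K \<subseteq> topspace T}"
    by (auto simp: exp_carrier_def dest: compactin_subset_topspace)
  then have "exp_carrier T \<in> vietoris_subbase T"
    unfolding vietoris_subbase_def using openin_topspace[of T] by blast
  moreover have "A \<subseteq> exp_carrier T" if "A \<in> vietoris_subbase T" for A
    using that by (auto simp: vietoris_subbase_def)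
  ultimately show ?thesis
    unfolding vietoris_def topology_generated_by_topspace by blast
qed

text \<open>The sort only asks for a vector space with some topology, since the
  compatibility of the two structures plays no role in the definition itself.\<close>

definition compactly_convex :: "'a::{real_vector,topological_space} set \<Rightarrow> bool"
  where "compactly_convex X \<longleftrightarrow> convex X \<and>
    (\<exists>\<Phi>. continuous_map (top_of_set X) (vietoris (top_of_set X)) \<Phi> \<and>
         (\<forall>x\<in>X. \<forall>y\<in>X. closed_segment x y \<subseteq> \<Phi> x \<union> \<Phi> y))"

end

theory Submission
  imports Defs
begin

text \<open>A natural candidate for \<open>\<Phi> x\<close> is a set reaching from \<open>x\<close> part of the way towards every
other point of \<open>X\<close>, so that on each segment \<open>[x, y]\<close> the points not covered from \<open>x\<close> are
covered from \<open>y\<close>. Since an arbitrary part of the boundary may be missing from \<open>X\<close>, the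
difficulty is to split the segments so that the sets stay compact and vary continuously.

It suffices to solve a weaker problem. Call \<open>G \<subseteq> X \<times> X\<close> subcontinuous if \<open>x\<^sub>n \<longlonglongrightarrow> x \<in> X\<close> and
\<open>(x\<^sub>n, p\<^sub>n) \<in> G\<close> imply that \<open>p\<^sub>n\<close> has a subsequence converging in \<open>X\<close>. If such a relation
covers every segment, in the sense that \<open>z \<in> [x, y]\<close> gives \<open>(x, z) \<in> G\<close> or \<open>(y, z) \<in> G\<close>, then
\<open>X\<close> is compactly convex (\<open>compactly_convexI_graph\<close>, in any Euclidean space): let \<open>\<Phi> x\<close> be
the closure of all the points \<open>p\<close> with \<open>(y, p) \<in> G\<close>, each contracted towards a fixed relative
interior point of \<open>X\<close>, the more strongly the farther \<open>y\<close> is from \<open>x\<close>. The contraction makes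
\<open>\<Phi>\<close> continuous, moves limits of points \<open>p\<close> that escape from \<open>X\<close> back into its relative
interior, and is trivial for \<open>y = x\<close>.

To find \<open>G\<close>, suppose that \<open>z\<^sub>n \<in> [x\<^sub>n, y\<^sub>n]\<close>, that \<open>x\<^sub>n \<longlonglongrightarrow> x \<in> X\<close> and that \<open>z\<^sub>n \<longlonglongrightarrow> z \<notin> X\<close>. Then
\<open>z\<^sub>n\<close> must be given to \<open>y\<^sub>n\<close>. If \<open>y\<^sub>n \<longlonglongrightarrow> y\<close>, then \<open>z \<in> [x, y]\<close> lies outside \<open>X\<close> and \<open>(z, y)\<close>
belongs to the set \<open>escape_pairs X\<close> of pairs in which \<open>z\<close> is a missing point seen from \<open>X\<close> in
the direction of \<open>y\<close>. Hence the rule: give \<open>z\<close> to that endpoint \<open>x\<close> or \<open>y\<close> for which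
\<open>(z, x)\<close> or \<open>(z, y)\<close> is closer to the escape pairs, with a weight that favours endpoints far
away. It yields a subcontinuous relation as soon as escape pairs \<open>(z\<^sub>n, y\<^sub>n)\<close> with
\<open>y\<^sub>n \<longlonglongrightarrow> x \<in> X\<close> satisfy \<open>z\<^sub>n \<longlonglongrightarrow> x\<close> (\<open>subcontinuous_priority_graph\<close>).

This last condition is where the plane is used (\<open>planar_escape_pairs_near\<close>). If \<open>z\<^sub>n\<close> stays
away from \<open>x\<close>, the segments through \<open>z\<^sub>n\<close> are chords in the boundary of \<open>X\<close> whose length is
bounded below and which accumulate at a boundary chord starting at \<open>x\<close>. A planar convex set
has no such sequence of chords in different lines, so some chord lies in one line with \<open>x\<close>; but
on a line a convex set has no gaps, and a missing point between \<open>y\<^sub>n\<close> and a point of \<open>X\<close> is no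
farther from \<open>x\<close> than \<open>y\<^sub>n\<close> is.\<close>

section \<open>Continuity into the Vietoris hyperspace\<close>

lemma continuous_map_vietorisI:
  fixes X :: "'a::topological_space set"
  assumes "\<And>x. x \<in> X \<Longrightarrow> compact (\<Phi> x) \<and> \<Phi> x \<noteq> {} \<and> \<Phi> x \<subseteq> X"
    and upper: "\<And>U. open U \<Longrightarrow> openin (top_of_set X) {x\<in>X. \<Phi> x \<subseteq> U}"
    and lower: "\<And>U. open U \<Longrightarrow> openin (top_of_set X) {x\<in>X. \<Phi> x \<inter> U \<noteq> {}}"
  shows "continuous_map (top_of_set X) (vietoris (top_of_set X)) \<Phi>"
proof -
  have car: "\<Phi> x \<in> exp_carrier (top_of_set X)" if "x \<in> X" for x
    using assms(1)[OF that] by (auto simp: exp_carrier_def compactin_subtopology)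
  show ?thesis
    unfolding vietoris_def
  proof (rule continuous_on_generated_topo)
    fix W assume "W \<in> vietoris_subbase (top_of_set X)"
    then obtain U where U: "open U"
      "W = {K \<in> exp_carrier (top_of_set X). K \<subseteq> X \<inter> U} \<or>
       W = {K \<in> exp_carrier (top_of_set X). K \<inter> (X \<inter> U) \<noteq> {}}"
      by (auto simp: vietoris_subbase_def openin_open)
    from U(2) show "openin (top_of_set X) (\<Phi> -` W \<inter> topspace (top_of_set X))"
    proof
      assume W: "W = {K \<in> exp_carrier (top_of_set X). K \<subseteq> X \<inter> U}"
      have "\<Phi> -` W \<inter> topspace (top_of_set X) = {x\<in>X. \<Phi> x \<subseteq> U}"
        using car assms(1) by (auto simp: W)
      then show ?thesis using upper[OF U(1)] by simp
    next
      assume W: "W = {K \<in> exp_carrier (top_of_set X). K \<inter> (X \<inter> U) \<noteq> {}}"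
      have "\<Phi> x \<inter> (X \<inter> U) = \<Phi> x \<inter> U" if "x \<in> X" for x using assms(1)[OF that] by blast
      then have "\<Phi> -` W \<inter> topspace (top_of_set X) = {x\<in>X. \<Phi> x \<inter> U \<noteq> {}}"
        using car by (auto simp: W)
      then show ?thesis using lower[OF U(1)] by simp
    qed
  next
    have "\<Phi> ` X \<subseteq> topspace (vietoris (top_of_set X))" using car by (auto simp: topspace_vietoris)
    then show "\<Phi> ` topspace (top_of_set X) \<subseteq> \<Union> (vietoris_subbase (top_of_set X))"
      by (simp add: vietoris_def)
  qed
qed

section \<open>Subcontinuous relations and compact convexity\<close>

text \<open>In the product of \<open>X\<close> with the one-point compactification of the whole space, the closure of
such a relation stays inside \<open>X \<times> X\<close>: its sections are relatively compact in \<open>X\<close>, locally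
uniformly at the points of \<open>X\<close>.\<close>

definition subcontinuous_graph :: "('a::topological_space \<times> 'a) set \<Rightarrow> 'a set \<Rightarrow> bool"
  where "subcontinuous_graph G X \<longleftrightarrow> G \<subseteq> X \<times> X \<and>
     (\<forall>\<xi> \<pi> x. (\<forall>n. (\<xi> n, \<pi> n) \<in> G) \<longrightarrow> x \<in> X \<longrightarrow> \<xi> \<longlonglongrightarrow> x \<longrightarrow>
        (\<exists>p\<in>X. \<exists>r::nat\<Rightarrow>nat. strict_mono r \<and> (\<pi> \<circ> r) \<longlonglongrightarrow> p))"

lemma subcontinuous_graphD:
  assumes "subcontinuous_graph G X" "\<And>n. (\<xi> n, \<pi> n) \<in> G" "x \<in> X" "\<xi> \<longlonglongrightarrow> x"
  obtains p r where "p \<in> X" "strict_mono (r::nat\<Rightarrow>nat)" "(\<lambda>n. \<pi> (r n)) \<longlonglongrightarrow> p"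
proof -
  have "\<exists>p\<in>X. \<exists>r::nat\<Rightarrow>nat. strict_mono r \<and> (\<pi> \<circ> r) \<longlonglongrightarrow> p"
    using assms unfolding subcontinuous_graph_def by (elim conjE allE[of _ \<xi>] allE[of _ \<pi>] allE[of _ x]) auto
  then show thesis using that by (auto simp: o_def)
qed

text \<open>An element \<open>(y, p)\<close> of the relation contributes to the set at \<open>x\<close> the point on the segment from
\<open>c\<close> to \<open>p\<close> with contraction factor \<open>1 / (1 + (1 + |p - c|) d)\<close>, where \<open>d = dist x y\<close>. The
factor is \<open>1\<close> for \<open>d = 0\<close>. If \<open>d \<ge> \<delta>\<close>, the summand \<open>1\<close> in front of \<open>|p - c|\<close> keeps it at
most \<open>1 / (1 + \<delta>)\<close>, and the norm \<open>|p - c|\<close> keeps the contracted point within distance \<open>1 / \<delta>\<close>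
from \<open>c\<close>, no matter how large \<open>p\<close> is.\<close>
definition shrink_toward :: "'a::real_normed_vector \<Rightarrow> 'a \<Rightarrow> 'a \<times> 'a \<Rightarrow> 'a"
  where "shrink_toward c x g =
           c + (1 / (1 + (1 + norm (snd g - c)) * dist x (fst g))) *\<^sub>R (snd g - c)"

lemma shrink_factor_pos: "0 < 1 + (1 + norm (v::'a::real_normed_vector)) * dist x (y::'b::metric_space)"
  by (intro add_pos_nonneg mult_nonneg_nonneg) auto

lemma shrink_toward_self [simp]: "shrink_toward c x (x, p) = p"
  by (simp add: shrink_toward_def)

lemma continuous_on_shrink_toward: "continuous_on S (\<lambda>x. shrink_toward c x g)"
  unfolding shrink_toward_def
  by (intro continuous_intros) (metis less_irrefl shrink_factor_pos)

lemma shrink_toward_in: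
  assumes "convex X" "c \<in> X" "snd g \<in> X"
  shows "shrink_toward c x g \<in> X"
proof -
  define k where "k = 1 / (1 + (1 + norm (snd g - c)) * dist x (fst g))"
  have "0 \<le> k" "k \<le> 1"
    using shrink_factor_pos[of "snd g - c" x "fst g"] by (auto simp: k_def divide_simps)
  moreover have "shrink_toward c x g = (1 - k) *\<^sub>R c + k *\<^sub>R snd g"
    by (simp add: shrink_toward_def k_def[symmetric] scaleR_diff_left scaleR_diff_right)
  ultimately show ?thesis using assms unfolding convex_alt by metis
qed

lemma subseq_tendsto_0_or_bounded_away:
  fixes f :: "nat \<Rightarrow> real"
  assumes "\<And>n. 0 \<le> f n"
  obtains r where "strict_mono (r::nat\<Rightarrow>nat)" "(f \<circ> r) \<longlonglongrightarrow> 0"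
  | r \<delta> where "strict_mono (r::nat\<Rightarrow>nat)" "0 < \<delta>" "\<And>n. \<delta> \<le> f (r n)"
proof -
  have "compact {0..1::real}" by simp
  moreover have "\<forall>n. min 1 (f n) \<in> {0..1}" using assms by simp
  ultimately obtain l r where l: "l \<in> {0..1}" "strict_mono r" "((\<lambda>n. min 1 (f n)) \<circ> r) \<longlonglongrightarrow> l"
    unfolding compact_def by (elim allE[of _ "\<lambda>n. min 1 (f n)"]) auto
  show thesis
  proof (cases "l = 0")
    case True
    have "\<forall>\<^sub>F n in sequentially. min 1 (f (r n)) < 1"
      using l(3) True by (intro order_tendstoD(2)[of _ 0]) (auto simp: o_def)
    then have "\<forall>\<^sub>F n in sequentially. min 1 (f (r n)) = (f \<circ> r) n"
      by eventually_elim auto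
    then have "(f \<circ> r) \<longlonglongrightarrow> 0"
      by (rule Lim_transform_eventually[rotated]) (use l(3) True in \<open>simp add: o_def\<close>)
    then show ?thesis using that(1) l(2) by blast
  next
    case False
    then have "0 < l" using l by auto
    then have "\<forall>\<^sub>F n in sequentially. l/2 < min 1 (f (r n))"
      using l(3) by (intro order_tendstoD(1)[of _ l]) (auto simp: o_def)
    then obtain N where N: "\<And>n. n \<ge> N \<Longrightarrow> l/2 < min 1 (f (r n))" by (auto simp: eventually_sequentially)
    show ?thesis
    proof (rule that(2)[of "\<lambda>n. r (n + N)" "l/2"])
      show "strict_mono (\<lambda>n. r (n + N))" using l(2) by (auto simp: strict_mono_def)
      show "l / 2 \<le> f (r (n + N))" for n using N[of "n + N"] by simp
    qed (use \<open>0 < l\<close> in auto)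
  qed
qed

text \<open>Both the compactness of the sets \<open>closure (shrink_toward c x ` G)\<close> and their upper
semicontinuity in \<open>x\<close> reduce to this statement. If the first coordinates of \<open>\<gamma>\<close> come close to
\<open>x\<close>, subcontinuity provides the limit \<open>q\<close>, because the contraction disappears. Otherwise
\<open>shrink_toward c x\<close> contracts all \<open>\<gamma> n\<close> by a factor bounded away from \<open>1\<close> into a bounded set, so
a limit exists and lies in the relative interior of \<open>X\<close>; and replacing \<open>x\<close> by the nearby
\<open>\<xi> n\<close> multiplies the contraction factors by something close to \<open>1\<close>, uniformly in the
possibly unbounded \<open>\<gamma> n\<close>.\<close>
lemma shrink_toward_cluster:
  fixes X :: "'a::euclidean_space set"
  assumes X: "convex X" and c: "c \<in> rel_interior X" and G: "subcontinuous_graph G X"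
    and x: "x \<in> X" "\<xi> \<longlonglongrightarrow> x" and \<gamma>: "\<And>n. \<gamma> n \<in> G"
  obtains q r where "q \<in> X" "strict_mono (r::nat\<Rightarrow>nat)"
    "(\<lambda>n. shrink_toward c x (\<gamma> (r n))) \<longlonglongrightarrow> q" "(\<lambda>n. shrink_toward c (\<xi> (r n)) (\<gamma> (r n))) \<longlonglongrightarrow> q"
proof -
  have cX: "c \<in> X" using c rel_interior_subset by blast
  have GX: "snd (\<gamma> n) \<in> X" for n using G \<gamma>[of n] by (auto simp: subcontinuous_graph_def)
  show thesis
  proof (rule subseq_tendsto_0_or_bounded_away[of "\<lambda>n. dist x (fst (\<gamma> n))"])
    fix r :: "nat \<Rightarrow> nat" assume r: "strict_mono r" "((\<lambda>n. dist x (fst (\<gamma> n))) \<circ> r) \<longlonglongrightarrow> 0"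
    then have z: "(\<lambda>n. fst (\<gamma> (r n))) \<longlonglongrightarrow> x" by (simp add: o_def tendsto_dist_iff[of _ x] dist_commute)
    obtain p s where p: "p \<in> X" "strict_mono s" "(\<lambda>n. snd (\<gamma> (r (s n)))) \<longlonglongrightarrow> p"
      by (rule subcontinuous_graphD[OF G, of "\<lambda>n. fst (\<gamma> (r n))" "\<lambda>n. snd (\<gamma> (r n))"]) (use \<gamma> z x(1) in auto)
    have z': "(\<lambda>n. fst (\<gamma> (r (s n)))) \<longlonglongrightarrow> x" using LIMSEQ_subseq_LIMSEQ[OF z p(2)] by (simp add: o_def)
    have \<xi>': "(\<lambda>n. \<xi> (r (s n))) \<longlonglongrightarrow> x"
      using LIMSEQ_subseq_LIMSEQ[OF x(2) strict_mono_o[OF r(1) p(2)]] by (simp add: o_def)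
    have lim: "(\<lambda>n. shrink_toward c (\<zeta> n) (\<gamma> (r (s n)))) \<longlonglongrightarrow> p" if "\<zeta> \<longlonglongrightarrow> x" for \<zeta>
    proof -
      have "(\<lambda>n. shrink_toward c (\<zeta> n) (\<gamma> (r (s n)))) \<longlonglongrightarrow>
              c + (1 / (1 + (1 + norm (p - c)) * dist x x)) *\<^sub>R (p - c)"
        unfolding shrink_toward_def by (intro tendsto_intros that z' p(3)) simp
      then show ?thesis by simp
    qed
    show thesis
      using that[OF p(1) strict_mono_o[OF r(1) p(2)]] lim[OF tendsto_const] lim[OF \<xi>'] by (simp add: o_def)
  next
    fix r :: "nat \<Rightarrow> nat" and \<delta> :: real
    assume r: "strict_mono r" "0 < \<delta>" and \<delta>: "\<And>n. \<delta> \<le> dist x (fst (\<gamma> (r n)))"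
    define m where "m n = 1 + norm (snd (\<gamma> (r n)) - c)" for n
    define d where "d n = dist x (fst (\<gamma> (r n)))" for n
    define e where "e n = dist (\<xi> (r n)) (fst (\<gamma> (r n)))" for n
    define Q where "Q n = shrink_toward c x (\<gamma> (r n))" for n
    have m: "1 \<le> m n" and d: "\<delta> \<le> d n" and e: "0 \<le> e n" for n using \<delta> by (auto simp: m_def d_def e_def)
    have md: "m n * \<delta> \<le> m n * d n" "\<delta> \<le> m n * \<delta>" for n
      using m[of n] d[of n] r(2) by (auto intro: mult_left_mono)
    have pos: "0 < 1 + m n * d n" "0 < 1 + m n * e n" for n
      using m[of n] d[of n] e[of n] r(2) by (auto intro!: add_pos_nonneg)
    have Q: "Q n - c = (1 / (1 + m n * d n)) *\<^sub>R (snd (\<gamma> (r n)) - c)" for n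
      by (simp add: Q_def shrink_toward_def m_def d_def)
    have bound: "norm (Q n - c) \<le> 1 / \<delta>" for n
    proof -
      have "norm (Q n - c) = norm (snd (\<gamma> (r n)) - c) / (1 + m n * d n)" using pos(1)[of n] by (simp add: Q)
      also have "\<dots> \<le> m n / (m n * \<delta>)"
      proof (rule frac_le)
        show "norm (snd (\<gamma> (r n)) - c) \<le> m n" by (simp add: m_def)
        show "0 < m n * \<delta>" "0 \<le> m n" using m[of n] r(2) by auto
        show "m n * \<delta> \<le> 1 + m n * d n" using md(1)[of n] by linarith
      qed
      finally show ?thesis using m[of n] by simp
    qed
    then have "bounded (range Q)"
      by (intro boundedI[of _ "norm c + 1 / \<delta>"]) (use norm_triangle_sub[of "Q _" c] in \<open>force intro: order_trans\<close>)
    then obtain q s where q: "strict_mono s" "(\<lambda>n. Q (s n)) \<longlonglongrightarrow> q"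
      using bounded_imp_convergent_subsequence[of Q] by (auto simp: o_def)
    \<comment> \<open>The contracted points stay in \<open>X\<close> when pushed outwards by the factor \<open>1 + \<delta>\<close>, so that
      their limit lies strictly between \<open>c\<close> and a point of the closure.\<close>
    have "c + (1 + \<delta>) *\<^sub>R (Q n - c) \<in> X" for n
    proof -
      define k where "k = (1 + \<delta>) / (1 + m n * d n)"
      have "\<delta> \<le> m n * d n" using md[of n] by linarith
      then have "0 \<le> k" "k \<le> 1" using pos(1)[of n] r(2) by (auto simp: k_def)
      moreover have "c + (1 + \<delta>) *\<^sub>R (Q n - c) = (1 - k) *\<^sub>R c + k *\<^sub>R snd (\<gamma> (r n))"
        by (simp add: Q k_def algebra_simps)
      ultimately show ?thesis using X cX GX[of "r n"] unfolding convex_alt by metis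
    qed
    moreover have "(\<lambda>n. c + (1 + \<delta>) *\<^sub>R (Q (s n) - c)) \<longlonglongrightarrow> c + (1 + \<delta>) *\<^sub>R (q - c)"
      by (intro tendsto_intros q)
    ultimately have "c + (1 + \<delta>) *\<^sub>R (q - c) \<in> closure X"
      by (intro Lim_in_closed_set[OF closed_closure _ trivial_limit_sequentially])
         (auto intro!: always_eventually subsetD[OF closure_subset])
    then have "c + (1 + \<delta>) *\<^sub>R (q - c) - (\<delta> / (1 + \<delta>)) *\<^sub>R (c + (1 + \<delta>) *\<^sub>R (q - c) - c) \<in> rel_interior X"
      using r(2) by (intro rel_interior_closure_convex_shrink[OF X c]) auto
    moreover have "c + (1 + \<delta>) *\<^sub>R (q - c) - (\<delta> / (1 + \<delta>)) *\<^sub>R (c + (1 + \<delta>) *\<^sub>R (q - c) - c) = q"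
    proof -
      have "(\<delta> / (1 + \<delta>)) *\<^sub>R (c + (1 + \<delta>) *\<^sub>R (q - c) - c) = \<delta> *\<^sub>R (q - c)"
        using r(2) by simp
      then show ?thesis by (simp only:) (simp add: algebra_simps)
    qed
    ultimately have qX: "q \<in> X" using rel_interior_subset by auto
    \<comment> \<open>\<open>\<theta> n\<close> is the quotient of the contraction factors at \<open>\<xi> (r n)\<close> and at \<open>x\<close>.\<close>
    define \<theta> where "\<theta> n = (1 + m n * d n) / (1 + m n * e n)" for n
    have \<xi>': "(\<lambda>n. dist (\<xi> (r n)) x) \<longlonglongrightarrow> 0"
    proof -
      have "(\<lambda>n. \<xi> (r n)) \<longlonglongrightarrow> x" using LIMSEQ_subseq_LIMSEQ[OF x(2) r(1)] by (simp add: o_def)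
      then show ?thesis by (rule tendsto_dist_iff[THEN iffD1])
    qed
    have "(\<lambda>n. \<theta> n - 1) \<longlonglongrightarrow> 0"
    proof (rule Lim_null_comparison)
      show "(\<lambda>n. dist (\<xi> (r n)) x / (\<delta>/2)) \<longlonglongrightarrow> 0"
        using tendsto_divide[OF \<xi>' tendsto_const, of "\<delta>/2"] r(2) by simp
      have "\<forall>\<^sub>F n in sequentially. dist (\<xi> (r n)) x < \<delta>/2"
        using order_tendstoD(2)[OF \<xi>', of "\<delta>/2"] r(2) by simp
      then show "\<forall>\<^sub>F n in sequentially. norm (\<theta> n - 1) \<le> dist (\<xi> (r n)) x / (\<delta>/2)"
      proof eventually_elim
        case (elim n)
        have de: "\<bar>d n - e n\<bar> \<le> dist (\<xi> (r n)) x"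
          unfolding d_def e_def using abs_dist_diff_le[of x "fst (\<gamma> (r n))" "\<xi> (r n)"] by (simp add: dist_commute)
        then have e2: "\<delta>/2 \<le> e n" using elim d[of n] by linarith
        have "\<theta> n - 1 = m n * (d n - e n) / (1 + m n * e n)"
          using pos(2)[of n] by (simp add: \<theta>_def field_simps)
        then have "norm (\<theta> n - 1) = m n * \<bar>d n - e n\<bar> / (1 + m n * e n)"
          using pos(2)[of n] m[of n] by (simp add: abs_mult)
        also have "\<dots> \<le> m n * dist (\<xi> (r n)) x / (m n * (\<delta>/2))"
          using de e2 m[of n] r(2) by (intro frac_le mult_left_mono) (auto intro!: add_increasing)
        finally show ?case using m[of n] by simp
      qed
    qed
    then have "(\<lambda>n. \<theta> n - 1 + 1) \<longlonglongrightarrow> 0 + 1" by (intro tendsto_intros)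
    then have \<theta>: "(\<lambda>n. \<theta> (s n)) \<longlonglongrightarrow> 1" using LIMSEQ_subseq_LIMSEQ[OF _ q(1)] by (force simp: o_def)
    have "shrink_toward c (\<xi> (r n)) (\<gamma> (r n)) = c + \<theta> n *\<^sub>R (Q n - c)" for n
      using pos(1)[of n] by (simp add: Q \<theta>_def) (simp add: shrink_toward_def m_def e_def)
    moreover have "(\<lambda>n. c + \<theta> (s n) *\<^sub>R (Q (s n) - c)) \<longlonglongrightarrow> c + 1 *\<^sub>R (q - c)"
      by (intro tendsto_intros \<theta> q)
    ultimately have "(\<lambda>n. shrink_toward c (\<xi> (r (s n))) (\<gamma> (r (s n)))) \<longlonglongrightarrow> q" by simp
    then show thesis
      using that[OF qX strict_mono_o[OF r(1) q(1)]] q(2) by (simp add: o_def Q_def)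
  qed auto
qed

text \<open>Lower semicontinuity of \<open>\<Phi>\<close> is immediate, since each \<open>\<lambda>x. shrink_toward c x g\<close> is continuous.
Upper semicontinuity and compactness come from \<open>shrink_toward_cluster\<close>, and \<open>\<Phi> x\<close> contains
the section of \<open>G\<close> at \<open>x\<close> because elements based at \<open>x\<close> are not contracted there.\<close>
lemma compactly_convexI_graph:
  fixes X :: "'a::euclidean_space set"
  assumes X: "convex X" and G: "subcontinuous_graph G X"
    and cover: "\<And>x y z. x \<in> X \<Longrightarrow> y \<in> X \<Longrightarrow> z \<in> closed_segment x y \<Longrightarrow> (x, z) \<in> G \<or> (y, z) \<in> G"
  shows "compactly_convex X"
proof (cases "X = {}")
  case True
  then show ?thesis by (simp add: compactly_convex_def)
next
  case False
  then obtain c where c: "c \<in> rel_interior X" using rel_interior_eq_empty[OF X] by blast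
  define \<Phi> where "\<Phi> x = closure (shrink_toward c x ` G)" for x
  have cX: "c \<in> X" using c rel_interior_subset by blast
  have Gne: "G \<noteq> {}" using cover[OF cX cX, of c] by auto
  have sX: "shrink_toward c x g \<in> X" if "g \<in> G" for x g
    using that G shrink_toward_in[OF X cX] by (auto simp: subcontinuous_graph_def)
  \<comment> \<open>For constant \<open>\<xi>\<close> this says that \<open>\<Phi> x\<close> is a compact subset of \<open>X\<close>.\<close>
  have cluster: "\<exists>q r. q \<in> X \<and> q \<in> \<Phi> x \<and> strict_mono (r::nat\<Rightarrow>nat) \<and> (\<lambda>n. k (r n)) \<longlonglongrightarrow> q"
    if x: "x \<in> X" "\<xi> \<longlonglongrightarrow> x" and k: "\<And>n. k n \<in> \<Phi> (\<xi> n)" for x \<xi> k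
  proof -
    have "\<exists>g\<in>G. dist (shrink_toward c (\<xi> n) g) (k n) < inverse (real (Suc n))" for n
      using k[of n] unfolding \<Phi>_def closure_approachable by (auto dest: spec[of _ "inverse (real (Suc n))"])
    then obtain \<gamma> where \<gamma>: "\<And>n. \<gamma> n \<in> G" "\<And>n. dist (shrink_toward c (\<xi> n) (\<gamma> n)) (k n) < inverse (real (Suc n))"
      by metis
    obtain q r where q: "q \<in> X" "strict_mono r" "(\<lambda>n. shrink_toward c x (\<gamma> (r n))) \<longlonglongrightarrow> q"
        "(\<lambda>n. shrink_toward c (\<xi> (r n)) (\<gamma> (r n))) \<longlonglongrightarrow> q"
      by (rule shrink_toward_cluster[OF X c G x \<gamma>(1)])
    have "q \<in> \<Phi> x" unfolding \<Phi>_def closure_sequential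
      by (rule exI[of _ "\<lambda>n. shrink_toward c x (\<gamma> (r n))"]) (use q(3) \<gamma>(1) in simp)
    moreover have "(\<lambda>n. k (r n)) \<longlonglongrightarrow> q"
    proof -
      have "(\<lambda>n. dist (k n) (shrink_toward c (\<xi> n) (\<gamma> n))) \<longlonglongrightarrow> 0"
        by (rule tendsto_sandwich[OF _ _ tendsto_const LIMSEQ_inverse_real_of_nat])
           (use \<gamma>(2) in \<open>auto intro!: always_eventually less_imp_le simp: dist_commute simp del: of_nat_Suc\<close>)
      then have "(\<lambda>n. k n - shrink_toward c (\<xi> n) (\<gamma> n)) \<longlonglongrightarrow> 0"
        by (simp add: dist_norm tendsto_norm_zero_iff)
      then have "(\<lambda>n. k (r n) - shrink_toward c (\<xi> (r n)) (\<gamma> (r n))) \<longlonglongrightarrow> 0"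
        using LIMSEQ_subseq_LIMSEQ[OF _ q(2)] by (force simp: o_def)
      then show ?thesis by (rule Lim_transform[OF q(4)])
    qed
    ultimately show ?thesis using q(1,2) by blast
  qed
  have sub: "\<Phi> x \<subseteq> X" if x: "x \<in> X" for x
  proof
    fix p assume "p \<in> \<Phi> x"
    then obtain q r where "q \<in> X" "(\<lambda>n::nat. p) \<longlonglongrightarrow> q"
      using cluster[OF x tendsto_const, of "\<lambda>n. p"] by auto
    then show "p \<in> X" by (simp add: LIMSEQ_const_iff)
  qed
  have comp: "compact (\<Phi> x)" if x: "x \<in> X" for x
    unfolding compact_def
  proof (intro allI impI)
    fix k :: "nat \<Rightarrow> 'a" assume "\<forall>n. k n \<in> \<Phi> x"
    then show "\<exists>l\<in>\<Phi> x. \<exists>r. strict_mono r \<and> (k \<circ> r) \<longlonglongrightarrow> l"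
      using cluster[OF x tendsto_const, of k] by (auto simp: o_def)
  qed
  have "continuous_map (top_of_set X) (vietoris (top_of_set X)) \<Phi>"
  proof (rule continuous_map_vietorisI)
    show "compact (\<Phi> x) \<and> \<Phi> x \<noteq> {} \<and> \<Phi> x \<subseteq> X" if "x \<in> X" for x
      using comp sub that Gne by (auto simp: \<Phi>_def)
  next
    fix U :: "'a set" assume U: "open U"
    have "closedin (top_of_set X) (X - {x\<in>X. \<Phi> x \<subseteq> U})"
      unfolding closedin_limpt islimpt_sequential
    proof (intro conjI allI impI, goal_cases)
      case (2 x)
      then obtain \<xi> where A: "\<And>n. \<xi> n \<in> X - {x \<in> X. \<Phi> x \<subseteq> U}" "x \<in> X" "\<xi> \<longlonglongrightarrow> x" by auto
      have "\<forall>n. \<exists>k. k \<in> \<Phi> (\<xi> n) \<and> k \<in> - U" using A(1) by blast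
      then obtain k where k: "\<And>n. k n \<in> \<Phi> (\<xi> n)" "\<And>n. k n \<in> - U" by metis
      obtain q r where q: "q \<in> \<Phi> x" "(\<lambda>n. k (r n)) \<longlonglongrightarrow> q"
        using cluster[of x \<xi> k] A(2,3) k(1) by blast
      have "q \<in> - U"
        by (rule Lim_in_closed_set[OF _ _ trivial_limit_sequentially q(2)]) (use U k(2) in auto)
      then show "x \<in> X - {x \<in> X. \<Phi> x \<subseteq> U}" using q(1) A by auto
    qed auto
    then show "openin (top_of_set X) {x\<in>X. \<Phi> x \<subseteq> U}"
      by (simp add: openin_closedin_eq)
  next
    fix U :: "'a set" assume U: "open U"
    have "{x\<in>X. \<Phi> x \<inter> U \<noteq> {}} = (\<Union>g\<in>G. X \<inter> (\<lambda>x. shrink_toward c x g) -` U)"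
      using open_Int_closure_eq_empty[OF U] by (auto simp: \<Phi>_def Int_commute)
    moreover have "openin (top_of_set X) (\<Union>g\<in>G. X \<inter> (\<lambda>x. shrink_toward c x g) -` U)"
      by (intro openin_Union ballI) (use continuous_openin_preimage_gen[OF continuous_on_shrink_toward U] in auto)
    ultimately show "openin (top_of_set X) {x\<in>X. \<Phi> x \<inter> U \<noteq> {}}" by simp
  qed
  moreover have "closed_segment x y \<subseteq> \<Phi> x \<union> \<Phi> y" if xy: "x \<in> X" "y \<in> X" for x y
  proof
    fix z assume "z \<in> closed_segment x y"
    then have "(x, z) \<in> G \<or> (y, z) \<in> G" using cover xy by blast
    then have "shrink_toward c x (x, z) \<in> shrink_toward c x ` G \<or> shrink_toward c y (y, z) \<in> shrink_toward c y ` G"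
      by blast
    then show "z \<in> \<Phi> x \<union> \<Phi> y"
      unfolding \<Phi>_def using closure_subset[of "shrink_toward c x ` G"] closure_subset[of "shrink_toward c y ` G"]
      by (simp only: shrink_toward_self) blast
  qed
  ultimately show ?thesis using X unfolding compactly_convex_def by blast
qed

section \<open>Splitting segments according to missing points\<close>

text \<open>A limit \<open>(z, y)\<close> of pairs \<open>(z\<^sub>n, y\<^sub>n)\<close> with \<open>z\<^sub>n\<close> on a segment from \<open>x\<^sub>n\<close> to \<open>y\<^sub>n\<close>, where \<open>x\<^sub>n\<close>
tends to a point of \<open>X\<close> but \<open>z\<^sub>n\<close> leaves \<open>X\<close>, is of this kind. By convexity \<open>y\<close> is missing too,
so giving \<open>z\<^sub>n\<close> to \<open>y\<^sub>n\<close> does no harm.\<close>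
definition escape_pairs :: "'a::euclidean_space set \<Rightarrow> ('a \<times> 'a) set"
  where "escape_pairs X = {(z, y). z \<in> closure X - X \<and> y \<in> closure X \<and>
                                   (\<exists>x\<in>X. z \<in> closed_segment x y)}"

text \<open>The distance of \<open>(z, x)\<close> from the escape pairs, truncated at \<open>1\<close>. The truncation settles the
value for closed \<open>X\<close>, where there are no escape pairs, and the denominator makes the
gap tend to \<open>0\<close> whenever \<open>x\<close> tends to infinity, so that infinity is treated like a missing
point. For closed \<open>X\<close> the endpoint of larger norm has the smaller gap.\<close>
definition escape_gap :: "'a::euclidean_space set \<Rightarrow> 'a \<Rightarrow> 'a \<Rightarrow> real"
  where "escape_gap X z x = Inf (insert 1 (dist (z, x) ` escape_pairs X)) / (1 + norm x)"

definition priority_graph :: "'a::euclidean_space set \<Rightarrow> ('a \<times> 'a) set"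
  where "priority_graph X = {(x, z). x \<in> X \<and>
           (\<exists>y\<in>X. z \<in> closed_segment x y \<and> escape_gap X z x \<le> escape_gap X z y)}"

lemma priority_graph_covers:
  assumes "x \<in> X" "y \<in> X" "z \<in> closed_segment x y"
  shows "(x, z) \<in> priority_graph X \<or> (y, z) \<in> priority_graph X"
  using assms linear[of "escape_gap X z x" "escape_gap X z y"]
  by (auto simp: priority_graph_def closed_segment_commute)

lemma escape_gap_bounds:
  shows "0 \<le> escape_gap X z x" "escape_gap X z x \<le> 1 / (1 + norm x)"
    "(p, y) \<in> escape_pairs X \<Longrightarrow> escape_gap X z x \<le> dist (z, x) (p, y)"
proof -
  let ?S = "insert 1 (dist (z, x) ` escape_pairs X)"
  have bdd: "bdd_below ?S" by (rule bdd_belowI[of _ 0]) auto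
  have n: "0 < 1 + norm x" by (simp add: add_pos_nonneg)
  have I: "0 \<le> Inf ?S" by (rule cInf_greatest) auto
  then show "0 \<le> escape_gap X z x" by (simp add: escape_gap_def)
  have "Inf ?S \<le> 1" by (rule cInf_lower[OF _ bdd]) simp
  then show "escape_gap X z x \<le> 1 / (1 + norm x)" using n by (simp add: escape_gap_def divide_right_mono)
  assume "(p, y) \<in> escape_pairs X"
  then have "Inf ?S \<le> dist (z, x) (p, y)" by (intro cInf_lower[OF _ bdd]) auto
  moreover have "escape_gap X z x \<le> Inf ?S / 1"
    unfolding escape_gap_def by (rule divide_left_mono) (use n I in auto)
  ultimately show "escape_gap X z x \<le> dist (z, x) (p, y)" by simp
qed

lemma escape_gap_less:
  assumes "escape_gap X z x < \<rho> / (1 + norm x)" "\<rho> \<le> 1"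
  obtains p y where "(p, y) \<in> escape_pairs X" "dist p z < \<rho>" "dist y x < \<rho>"
proof -
  let ?S = "insert 1 (dist (z, x) ` escape_pairs X)"
  have bdd: "bdd_below ?S" by (rule bdd_belowI[of _ 0]) auto
  have "0 < 1 + norm x" by (simp add: add_pos_nonneg)
  then have "Inf ?S < \<rho>" using assms(1) by (simp add: escape_gap_def divide_less_cancel)
  then obtain s where "s \<in> ?S" "s < \<rho>" using cInf_less_iff[OF _ bdd] by blast
  then obtain p y where py: "(p, y) \<in> escape_pairs X" "dist (z, x) (p, y) < \<rho>" using assms(2) by auto
  then show thesis
    using that dist_fst_le[of "(z, x)" "(p, y)"] dist_snd_le[of "(z, x)" "(p, y)"] by (auto simp: dist_commute)
qed

lemma subseq_convergent_or_unbounded: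
  fixes s :: "nat \<Rightarrow> 'a::euclidean_space"
  obtains l r where "strict_mono (r::nat\<Rightarrow>nat)" "(\<lambda>n. s (r n)) \<longlonglongrightarrow> l"
  | r where "strict_mono (r::nat\<Rightarrow>nat)" "(\<lambda>n. 1 / (1 + norm (s (r n)))) \<longlonglongrightarrow> 0"
proof (rule subseq_tendsto_0_or_bounded_away[of "\<lambda>n. 1 / (1 + norm (s n))"])
  fix r :: "nat \<Rightarrow> nat" and \<delta> :: real
  assume r: "strict_mono r" "0 < \<delta>" "\<And>n. \<delta> \<le> 1 / (1 + norm (s (r n)))"
  have "norm (s (r n)) \<le> 1 / \<delta>" for n
  proof -
    have "0 < 1 + norm (s (r n))" by (simp add: add_pos_nonneg)
    then have "1 + norm (s (r n)) \<le> 1 / \<delta>" using r(2) r(3)[of n] by (simp add: field_simps)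
    then show ?thesis by linarith
  qed
  then have "bounded (range (s \<circ> r))" by (intro boundedI[of _ "1/\<delta>"]) auto
  then obtain l t where "strict_mono t" "(\<lambda>n. s (r (t n))) \<longlonglongrightarrow> l"
    using bounded_imp_convergent_subsequence[of "s \<circ> r"] by (auto simp: o_def)
  then show thesis using that(1)[OF strict_mono_o[OF r(1)]] by (simp add: o_def)
qed (use that(2) in \<open>auto simp: o_def\<close>)

text \<open>Let \<open>\<pi> n\<close> be given to \<open>\<xi> n\<close> against the other endpoint \<open>y n\<close>. If \<open>\<pi>\<close> accumulates only
outside \<open>X\<close> or at infinity, the gap at \<open>y n\<close> tends to \<open>0\<close>, hence so does the smaller gap at
\<open>\<xi> n\<close>. As \<open>\<xi>\<close> converges to \<open>x \<in> X\<close>, this produces escape pairs whose second components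
tend to \<open>x\<close> and whose first components are close to \<open>\<pi> n\<close>, and the hypothesis \<open>near\<close> forces
\<open>\<pi>\<close> to converge to \<open>x\<close> itself.\<close>
lemma subcontinuous_priority_graph:
  fixes X :: "'a::euclidean_space set"
  assumes X: "convex X"
    and near: "\<And>x \<epsilon>. x \<in> X \<Longrightarrow> \<epsilon> > 0 \<Longrightarrow> \<exists>\<delta>>0. \<forall>(z, y) \<in> escape_pairs X. dist y x < \<delta> \<longrightarrow> dist z x < \<epsilon>"
  shows "subcontinuous_graph (priority_graph X) X"
  unfolding subcontinuous_graph_def
proof (intro conjI allI impI)
  show "priority_graph X \<subseteq> X \<times> X"
    using closed_segment_subset[OF _ _ X] by (auto simp: priority_graph_def)
next
  fix \<xi> \<pi> :: "nat \<Rightarrow> 'a" and x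
  assume G: "\<forall>n. (\<xi> n, \<pi> n) \<in> priority_graph X" and x: "x \<in> X" "\<xi> \<longlonglongrightarrow> x"
  from G have "\<forall>n. \<exists>y. y \<in> X \<and> \<pi> n \<in> closed_segment (\<xi> n) y \<and>
      escape_gap X (\<pi> n) (\<xi> n) \<le> escape_gap X (\<pi> n) y"
    by (auto simp: priority_graph_def)
  then obtain y where y: "\<And>n. y n \<in> X" "\<And>n. \<pi> n \<in> closed_segment (\<xi> n) (y n)"
      "\<And>n. escape_gap X (\<pi> n) (\<xi> n) \<le> escape_gap X (\<pi> n) (y n)"
    by metis
  have \<xi>X: "\<xi> n \<in> X" for n using G by (auto simp: priority_graph_def)
  have \<pi>X: "\<pi> n \<in> X" for n using closed_segment_subset[OF \<xi>X y(1) X] y(2) by blast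
  have \<xi>': "(\<lambda>n. \<xi> (r n)) \<longlonglongrightarrow> x" if "strict_mono r" for r :: "nat \<Rightarrow> nat"
    using LIMSEQ_subseq_LIMSEQ[OF x(2) that] by (simp add: o_def)
  have key: "(\<lambda>n. \<pi> (r n)) \<longlonglongrightarrow> x"
    if r: "strict_mono r" and gap: "(\<lambda>n. escape_gap X (\<pi> (r n)) (y (r n))) \<longlonglongrightarrow> 0" for r :: "nat \<Rightarrow> nat"
  proof (rule tendstoI)
    fix \<epsilon> :: real assume \<epsilon>: "\<epsilon> > 0"
    obtain \<delta> where \<delta>: "\<delta> > 0" "\<And>z y. (z, y) \<in> escape_pairs X \<Longrightarrow> dist y x < \<delta> \<Longrightarrow> dist z x < \<epsilon>/2"
      using near[OF x(1), of "\<epsilon>/2"] \<epsilon> by auto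
    define \<rho> where "\<rho> = min 1 (min (\<epsilon>/2) (\<delta>/2))"
    have \<rho>: "0 < \<rho>" "\<rho> \<le> 1" "\<rho> \<le> \<epsilon>/2" "\<rho> \<le> \<delta>/2" using \<epsilon> \<delta>(1) by (auto simp: \<rho>_def)
    have "(\<lambda>n. escape_gap X (\<pi> (r n)) (y (r n)) * (1 + norm (\<xi> (r n)))) \<longlonglongrightarrow> 0 * (1 + norm x)"
      by (intro tendsto_intros gap \<xi>' r)
    then have "\<forall>\<^sub>F n in sequentially. escape_gap X (\<pi> (r n)) (y (r n)) * (1 + norm (\<xi> (r n))) < \<rho>"
      by (rule order_tendstoD(2)) (use \<rho> in simp)
    moreover have "\<forall>\<^sub>F n in sequentially. dist (\<xi> (r n)) x < \<delta>/2"
      using tendstoD[OF \<xi>'[OF r], of "\<delta>/2"] \<delta>(1) by simp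
    ultimately show "\<forall>\<^sub>F n in sequentially. dist (\<pi> (r n)) x < \<epsilon>"
    proof eventually_elim
      case (elim n)
      have "0 < 1 + norm (\<xi> (r n))" by (simp add: add_pos_nonneg)
      then have "escape_gap X (\<pi> (r n)) (y (r n)) < \<rho> / (1 + norm (\<xi> (r n)))"
        using elim(1) by (simp add: pos_less_divide_eq)
      then have "escape_gap X (\<pi> (r n)) (\<xi> (r n)) < \<rho> / (1 + norm (\<xi> (r n)))"
        using y(3)[of "r n"] by linarith
      then obtain p q where pq: "(p, q) \<in> escape_pairs X" "dist p (\<pi> (r n)) < \<rho>" "dist q (\<xi> (r n)) < \<rho>"
        using \<rho>(2) by (rule escape_gap_less)
      have "dist q x < \<delta>" using dist_triangle[of q x "\<xi> (r n)"] pq(3) elim(2) \<rho>(4) by linarith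
      then have "dist p x < \<epsilon>/2" using \<delta>(2) pq(1) by blast
      then show ?case
        using dist_triangle[of "\<pi> (r n)" x p] pq(2) \<rho>(3) dist_commute[of p "\<pi> (r n)"] by linarith
    qed
  qed
  show "\<exists>p\<in>X. \<exists>r::nat\<Rightarrow>nat. strict_mono r \<and> (\<pi> \<circ> r) \<longlonglongrightarrow> p"
  proof (rule subseq_convergent_or_unbounded[of y])
    fix r :: "nat \<Rightarrow> nat" assume r: "strict_mono r" "(\<lambda>n. 1 / (1 + norm (y (r n)))) \<longlonglongrightarrow> 0"
    have "(\<lambda>n. escape_gap X (\<pi> (r n)) (y (r n))) \<longlonglongrightarrow> 0"
      by (rule tendsto_sandwich[OF _ _ tendsto_const r(2)]) (simp_all add: escape_gap_bounds)
    then show ?thesis using key[OF r(1)] r(1) x(1) by (auto simp: o_def)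
  next
    fix r :: "nat \<Rightarrow> nat" and l assume r: "strict_mono r" "(\<lambda>n. y (r n)) \<longlonglongrightarrow> l"
    have "\<forall>n. \<exists>t. t \<in> {0..1} \<and> \<pi> n = (1 - t) *\<^sub>R \<xi> n + t *\<^sub>R y n"
      using y(2) by (fastforce simp: in_segment)
    then obtain t where t: "\<And>n. t n \<in> {0..1::real}" "\<And>n. \<pi> n = (1 - t n) *\<^sub>R \<xi> n + t n *\<^sub>R y n" by metis
    obtain \<tau> s where s: "\<tau> \<in> {0..1}" "strict_mono s" "(\<lambda>n. t (r (s n))) \<longlonglongrightarrow> \<tau>"
    proof -
      have "compact {0..1::real}" by simp
      then show ?thesis using t(1) that unfolding compact_def by (elim allE[of _ "t \<circ> r"]) (auto simp: o_def)
    qed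
    define R where "R = r \<circ> s"
    have R: "strict_mono R" unfolding R_def by (rule strict_mono_o[OF r(1) s(2)])
    have yR: "(\<lambda>n. y (R n)) \<longlonglongrightarrow> l" using LIMSEQ_subseq_LIMSEQ[OF r(2) s(2)] by (simp add: o_def R_def)
    define p where "p = (1 - \<tau>) *\<^sub>R x + \<tau> *\<^sub>R l"
    have pR: "(\<lambda>n. \<pi> (R n)) \<longlonglongrightarrow> p"
      unfolding t(2) p_def by (intro tendsto_intros \<xi>' R yR) (use s(3) in \<open>simp_all add: R_def\<close>)
    show ?thesis
    proof (cases "p \<in> X")
      case True
      then show ?thesis using pR R by (auto simp: o_def)
    next
      case False
      have "p \<in> closure X" "l \<in> closure X"
        using Lim_in_closed_set[OF closed_closure _ trivial_limit_sequentially pR]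
          Lim_in_closed_set[OF closed_closure _ trivial_limit_sequentially yR] \<pi>X y(1) closure_subset[of X]
        by (auto simp: subset_iff)
      moreover have "p \<in> closed_segment x l" using s(1) by (auto simp: p_def in_segment)
      ultimately have esc: "(p, l) \<in> escape_pairs X" using False x(1) by (auto simp: escape_pairs_def)
      have "(\<lambda>n. dist (\<pi> (R n), y (R n)) (p, l)) \<longlonglongrightarrow> dist (p, l) (p, l)"
        by (intro tendsto_intros pR yR)
      then have "(\<lambda>n. dist (\<pi> (R n), y (R n)) (p, l)) \<longlonglongrightarrow> 0" by simp
      then have "(\<lambda>n. escape_gap X (\<pi> (R n)) (y (R n))) \<longlonglongrightarrow> 0"
        by (rule tendsto_sandwich[OF _ _ tendsto_const, rotated 2]) (simp_all add: escape_gap_bounds esc)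
      then show ?thesis using key[OF R] R x(1) by (auto simp: o_def)
    qed
  qed
qed

section \<open>Boundary chords of planar convex sets\<close>

lemma orthonormal_expand_2:
  fixes a u v :: "real^2"
  assumes "norm a = 1" "norm u = 1" "a \<bullet> u = 0"
  shows "v = (a \<bullet> v) *\<^sub>R a + (u \<bullet> v) *\<^sub>R u"
proof -
  have 1: "a$1*a$1 + a$2*a$2 = 1" "u$1*u$1 + u$2*u$2 = 1" "a$1*u$1+a$2*u$2 = 0"
    using assms by (simp_all add: norm_eq_1 inner_vec_def sum_2)
  have "v$1 = (a$1 * v$1 + a$2 * v$2)*a$1 + (u$1 * v$1 + u$2 * v$2)*u$1"
    using 1 by algebra
  moreover have "v$2 = (a$1 * v$1 + a$2 * v$2)*a$2 + (u$1 * v$1 + u$2 * v$2)*u$2"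
    using 1 by algebra
  ultimately show ?thesis
    by (simp add: vec_eq_iff forall_2 inner_vec_def sum_2)
qed

text \<open>Two boundary chords of length \<open>\<delta>\<close> start at points that differ by \<open>e\<close>, with directions \<open>u\<close> and
\<open>u'\<close> and inner unit normals \<open>a\<close> and \<open>a'\<close> of supporting lines; \<open>f\<close> is the displacement of the far
end. The sign conditions say that each chord lies on the inner side of the line of the other.
For nearly parallel chords that are close to each other this forces them into one line: with
\<open>a' = c a + s u\<close> the conditions for \<open>a'\<close> bound \<open>c P\<close>, where \<open>P = a \<bullet> e + a \<bullet> f\<close> measures the
deviation from the line, by \<open>|s| (|e| + |f|)\<close>; but the tilt \<open>s\<close> is itself at most
\<open>2 P / \<delta>\<close>, so \<open>P\<close> is bounded by a small multiple of itself.\<close>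
lemma boundary_chord_rigid:
  fixes a a' u u' e f :: "real^2" and \<delta> :: real
  assumes unit: "norm a = 1" "norm u = 1" "norm a' = 1" "norm u' = 1"
    and orth: "a \<bullet> u = 0" "a' \<bullet> u' = 0"
    and \<delta>: "\<delta> > 0" and f: "f = e + \<delta> *\<^sub>R (u' - u)"
    and sup: "0 \<le> a \<bullet> e" "0 \<le> a \<bullet> f" and sup': "a' \<bullet> e \<le> 0" "a' \<bullet> f \<le> 0"
    and near: "1/2 \<le> a \<bullet> a'" "1/2 \<le> u \<bullet> u'" and small: "norm e + norm f < \<delta> / 8"
  shows "a \<bullet> e = 0" "a \<bullet> u' = 0"
proof -
  define c s P where "c = a \<bullet> a'" and "s = u \<bullet> a'" and "P = a \<bullet> e + a \<bullet> f"
  have a': "a' = c *\<^sub>R a + s *\<^sub>R u"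
    unfolding c_def s_def by (rule orthonormal_expand_2) (use unit orth in auto)
  have c: "1/2 \<le> c" "c \<le> 1"
    using near unit norm_cauchy_schwarz[of a a'] by (auto simp: c_def)
  have P: "0 \<le> P" using sup by (simp add: P_def)
  have "\<delta> * (a \<bullet> u') = a \<bullet> f - a \<bullet> e"
    by (simp add: f algebra_simps orth)
  then have au: "\<delta> * \<bar>a \<bullet> u'\<bar> \<le> P"
    using sup \<delta> by (simp add: P_def abs_if split: if_splits)
  have "s * (u \<bullet> u') = - c * (a \<bullet> u')"
    using orth(2) by (simp add: a' inner_add_left)
  then have "\<bar>s\<bar> * (u \<bullet> u') = c * \<bar>a \<bullet> u'\<bar>"
    using near c
    by (metis abs_minus_cancel abs_mult abs_of_nonneg mult_minus_left order_trans
          zero_le_divide_1_iff zero_le_numeral)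
  moreover have "\<bar>s\<bar> * (1/2) \<le> \<bar>s\<bar> * (u \<bullet> u')" using near by (intro mult_left_mono) auto
  moreover have "c * \<bar>a \<bullet> u'\<bar> \<le> 1 * \<bar>a \<bullet> u'\<bar>" using c by (intro mult_right_mono) auto
  ultimately have s: "\<bar>s\<bar> \<le> 2 * \<bar>a \<bullet> u'\<bar>" by linarith
  have "\<delta> * \<bar>s\<bar> \<le> \<delta> * (2 * \<bar>a \<bullet> u'\<bar>)"
    using s \<delta> by (intro mult_left_mono) auto
  then have s': "\<delta> * \<bar>s\<bar> \<le> 2 * P" using au by linarith
  have ue: "\<bar>s * (u \<bullet> e)\<bar> \<le> \<bar>s\<bar> * norm e" "\<bar>s * (u \<bullet> f)\<bar> \<le> \<bar>s\<bar> * norm f"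
    using Cauchy_Schwarz_ineq2[of u e] Cauchy_Schwarz_ineq2[of u f] unit
    by (auto simp: abs_mult intro!: mult_left_mono)
  have "c * P \<le> - (s * (u \<bullet> e)) - s * (u \<bullet> f)"
    using sup' by (simp add: a' P_def inner_add_left algebra_simps)
  also have "\<dots> \<le> \<bar>s\<bar> * (norm e + norm f)"
    using ue by (simp add: algebra_simps)
  finally have cP: "c * P \<le> \<bar>s\<bar> * (norm e + norm f)" .
  \<comment> \<open>The bound \<open>\<delta> / 8\<close> turns \<open>|s| \<le> 2 P / \<delta>\<close> into \<open>c P \<le> P / 4\<close>, against \<open>c \<ge> 1/2\<close>.\<close>
  have "P = 0"
  proof (rule ccontr)
    assume "P \<noteq> 0"
    then have "0 < P" using P by simp
    have "\<bar>s\<bar> * (norm e + norm f) \<le> \<bar>s\<bar> * (\<delta>/8)"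
      using small by (intro mult_left_mono) auto
    also have "\<dots> \<le> P / 4" using s' by (simp add: mult.commute)
    finally have "c * P \<le> P / 4" using cP by linarith
    moreover have "P / 2 \<le> c * P" using c P mult_right_mono[of "1/2" c P] by simp
    ultimately show False using \<open>0 < P\<close> by linarith
  qed
  then show "a \<bullet> e = 0" using sup by (simp add: P_def)
  show "a \<bullet> u' = 0" using au \<open>P = 0\<close> \<delta>
    by (simp add: mult_le_0_iff)
qed

text \<open>On a line, \<open>[w, v]\<close> is contained in \<open>[w, x] \<union> [x, v]\<close>, and \<open>[w, x] \<subseteq> X\<close> when \<open>w\<close> and \<open>x\<close> lie in
\<open>X\<close>; so a point of \<open>[w, v]\<close> missing from \<open>X\<close> lies between \<open>x\<close> and \<open>v\<close>.\<close>
lemma missing_point_on_line_near: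
  fixes x u :: "'a::euclidean_space"
  assumes "convex X" "x \<in> X" and w: "x + \<mu> *\<^sub>R u \<in> X"
    and z: "z \<in> closed_segment (x + \<mu> *\<^sub>R u) (x + \<rho> *\<^sub>R u)" "z \<notin> X"
  shows "dist z x \<le> dist (x + \<rho> *\<^sub>R u) x"
proof -
  obtain t where t: "0 \<le> t" "t \<le> 1" "z = (1-t) *\<^sub>R (x + \<mu> *\<^sub>R u) + t *\<^sub>R (x + \<rho> *\<^sub>R u)"
    using z(1) by (auto simp: in_segment)
  define \<nu> where "\<nu> = (1-t) * \<mu> + t * \<rho>"
  have zv: "z = x + \<nu> *\<^sub>R u" by (simp add: t \<nu>_def algebra_simps)
  have "\<nu> \<notin> closed_segment 0 \<mu>"
  proof
    assume "\<nu> \<in> closed_segment 0 \<mu>"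
    then obtain r where r: "0 \<le> r" "r \<le> 1" "\<nu> = r * \<mu>" by (auto simp: in_segment)
    have "z = (1-r) *\<^sub>R x + r *\<^sub>R (x + \<mu> *\<^sub>R u)" by (simp add: zv r algebra_simps)
    then have "z \<in> X" using assms(1,2) w r unfolding convex_alt by metis
    with z(2) show False by simp
  qed
  moreover have "\<nu> \<in> closed_segment \<mu> \<rho>" using t by (auto simp: \<nu>_def in_segment)
  ultimately have "\<bar>\<nu>\<bar> \<le> \<bar>\<rho>\<bar>" by (auto simp: closed_segment_eq_real_ivl split: if_splits)
  then show ?thesis by (simp add: zv dist_norm mult_right_mono)
qed

lemma unit_pairs_subsequence:
  fixes a u :: "nat \<Rightarrow> 'a::euclidean_space"
  assumes "\<And>n. norm (a n) = 1" "\<And>n. norm (u n) = 1"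
  obtains l m r where "norm l = 1" "norm m = 1" "strict_mono (r::nat\<Rightarrow>nat)"
    "(\<lambda>n. a (r n)) \<longlonglongrightarrow> l" "(\<lambda>n. u (r n)) \<longlonglongrightarrow> m"
proof -
  have "compact (sphere (0::'a) 1 \<times> sphere (0::'a) 1)" by (intro compact_Times) auto
  then obtain lm r where lm: "lm \<in> sphere (0::'a) 1 \<times> sphere (0::'a) 1" "strict_mono r"
     "((\<lambda>n. (a n, u n)) \<circ> r) \<longlonglongrightarrow> lm"
    using assms unfolding compact_def
    by (elim allE[of _ "\<lambda>n. (a n, u n)"]) auto
  show thesis
  proof (rule that[of "fst lm" "snd lm" r])
    show "(\<lambda>n. a (r n)) \<longlonglongrightarrow> fst lm" using tendsto_fst[OF lm(3)] by (simp add: o_def)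
    show "(\<lambda>n. u (r n)) \<longlonglongrightarrow> snd lm" using tendsto_snd[OF lm(3)] by (simp add: o_def)
  qed (use lm in auto)
qed

text \<open>In a counterexample there are \<open>w n \<in> X\<close>, \<open>v n \<longlonglongrightarrow> x\<close> and missing points \<open>z n \<in> [w n, v n]\<close> at
distance at least \<open>\<epsilon>\<close> from \<open>x\<close>. A supporting line at \<open>z n\<close> contains the whole segment, as
\<open>z n\<close> is an inner point of it. Along a subsequence the directions and the normals converge, and the
limit is a boundary chord starting at \<open>x\<close>, to which \<open>boundary_chord_rigid\<close> applies. Only the
initial part of length \<open>\<epsilon> / 2\<close> of each segment enters, since \<open>w n\<close> may tend to infinity.\<close>
lemma planar_escape_pairs_near:
  fixes X :: "(real^2) set"
  assumes X: "convex X" and x: "x \<in> X" and \<epsilon>: "\<epsilon> > 0"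
  shows "\<exists>\<delta>>0. \<forall>(z, y) \<in> escape_pairs X. dist y x < \<delta> \<longrightarrow> dist z x < \<epsilon>"
proof (rule ccontr)
  assume "\<not> ?thesis"
  then have "\<exists>z y. (z, y) \<in> escape_pairs X \<and> dist y x < inverse (real (Suc n)) \<and> \<epsilon> \<le> dist z x" for n
    by (force simp: not_less dest: spec[of _ "inverse (real (Suc n))"])
  then obtain z v where zv: "\<And>n. (z n, v n) \<in> escape_pairs X"
      "\<And>n. dist (v n) x < inverse (real (Suc n))" "\<And>n. \<epsilon> \<le> dist (z n) x"
    by metis
  have "v \<longlonglongrightarrow> x"
  proof (rule metric_tendsto_imp_tendsto[OF LIMSEQ_inverse_real_of_nat])
    show "\<forall>\<^sub>F n in sequentially. dist (v n) x \<le> dist (inverse (real (Suc n))) 0"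
      using zv(2) by (intro always_eventually) (simp add: less_imp_le)
  qed
  define \<delta> where "\<delta> = \<epsilon> / 2"
  have \<delta>: "\<delta> > 0" using \<epsilon> by (simp add: \<delta>_def)
  have "\<forall>n. \<exists>w. w \<in> X \<and> z n \<in> closed_segment w (v n)" using zv(1) by (auto simp: escape_pairs_def)
  then obtain w where w: "\<And>n. w n \<in> X" "\<And>n. z n \<in> closed_segment (w n) (v n)" by metis
  have zX: "z n \<in> closure X" "z n \<notin> X" and vX: "v n \<in> closure X" for n
    using zv(1)[of n] by (auto simp: escape_pairs_def)
  have "w n \<noteq> v n" for n
    using w[of n] zX(2)[of n] by (metis closed_segment_idem singletonD)
  define u where "u n = (w n - v n) /\<^sub>R norm (w n - v n)" for n
  have u1: "norm (u n) = 1" for n using \<open>w n \<noteq> v n\<close> by (simp add: u_def)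
  have wu: "w n = v n + norm (w n - v n) *\<^sub>R u n" for n using \<open>w n \<noteq> v n\<close> by (simp add: u_def)
  have "\<exists>a. norm a = 1 \<and> (\<forall>p\<in>closure X. a \<bullet> z n \<le> a \<bullet> p)" for n
  proof -
    have "z n \<notin> rel_interior X" using zX rel_interior_subset by blast
    then obtain a where a: "a \<noteq> 0" "\<And>p. p \<in> closure X \<Longrightarrow> a \<bullet> z n \<le> a \<bullet> p"
      using supporting_hyperplane_relative_frontier[OF X zX(1)] by metis
    show ?thesis
      using a by (intro exI[of _ "a /\<^sub>R norm a"]) (auto simp: divide_right_mono mult_left_mono)
  qed
  then obtain a where a1: "\<And>n. norm (a n) = 1" and asup: "\<And>n p. p \<in> closure X \<Longrightarrow> a n \<bullet> z n \<le> a n \<bullet> p"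
    by metis
  obtain b d r where b: "norm b = 1" "norm d = 1" "strict_mono r"
    "(\<lambda>n. a (r n)) \<longlonglongrightarrow> b" "(\<lambda>n. u (r n)) \<longlonglongrightarrow> d"
    by (rule unit_pairs_subsequence[OF a1 u1])
  have vr: "(\<lambda>n. v (r n)) \<longlonglongrightarrow> x" using LIMSEQ_subseq_LIMSEQ[OF \<open>v \<longlonglongrightarrow> x\<close> b(3)] by (simp add: o_def)
  define q where "q n = v n + \<delta> *\<^sub>R u n" for n
  have qr: "(\<lambda>n. q (r n)) \<longlonglongrightarrow> x + \<delta> *\<^sub>R d" unfolding q_def by (intro tendsto_intros vr b)
  have far: "dist (v n) x < \<delta> \<Longrightarrow> z n \<noteq> v n \<and> q n \<in> closure X \<and> a n \<bullet> v n = a n \<bullet> z n \<and> a n \<bullet> u n = 0" for n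
  proof -
    assume vn: "dist (v n) x < \<delta>"
    obtain t where t: "0 \<le> t" "t \<le> 1" "z n = (1-t) *\<^sub>R v n + t *\<^sub>R w n"
      using w(2)[of n] by (auto simp: in_segment closed_segment_commute[of "w n"])
    have zt: "z n = v n + (t * norm (w n - v n)) *\<^sub>R u n"
    proof -
      have "(t * norm (w n - v n)) *\<^sub>R u n = t *\<^sub>R (w n - v n)"
        using \<open>w n \<noteq> v n\<close> by (simp add: u_def)
      then show ?thesis by (simp add: t(3) algebra_simps)
    qed
    have "\<epsilon> \<le> dist (z n) (v n) + dist (v n) x"
      using zv(3)[of n] dist_triangle[of "z n" x "v n"] by linarith
    then have tn: "\<delta> < t * norm (w n - v n)"
      using vn t(1) u1[of n] by (simp add: zt dist_norm \<delta>_def)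
    have t0: "0 < t" using tn \<delta> t(1) by (cases "t = 0") auto
    have t1: "t < 1" using t w(1)[of n] zX(2)[of n] by (cases "t = 1") auto
    have "norm (w n - v n) > 0" using \<open>w n \<noteq> v n\<close> by simp
    have "q n = (1 - \<delta> / norm (w n - v n)) *\<^sub>R v n + (\<delta> / norm (w n - v n)) *\<^sub>R w n"
      using \<open>w n \<noteq> v n\<close> by (simp add: q_def u_def algebra_simps divide_inverse)
    moreover have "\<delta> \<le> norm (w n - v n)"
      using tn t1 mult_right_mono[of t 1 "norm (w n - v n)"] by simp
    ultimately have "q n \<in> closure X"
      using convex_closure[OF X] vX[of n] closure_subset[of X] w(1)[of n] \<delta> \<open>norm (w n - v n) > 0\<close>
      unfolding convex_alt by (smt (verit) divide_le_eq_1 divide_nonneg_nonneg subsetD)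
    moreover have az: "a n \<bullet> z n \<le> a n \<bullet> v n" "a n \<bullet> z n \<le> a n \<bullet> w n"
      using asup vX w(1) closure_subset[of X] by blast+
    have azt: "(1-t) * (a n \<bullet> v n - a n \<bullet> z n) + t * (a n \<bullet> w n - a n \<bullet> z n) = 0"
      using arg_cong[OF t(3), of "inner (a n)"] by (simp add: inner_add_right algebra_simps)
    have "0 \<le> (1-t) * (a n \<bullet> v n - a n \<bullet> z n)" "0 \<le> t * (a n \<bullet> w n - a n \<bullet> z n)"
      using az t0 t1 by auto
    then have "(1-t) * (a n \<bullet> v n - a n \<bullet> z n) = 0" "t * (a n \<bullet> w n - a n \<bullet> z n) = 0" using azt by linarith+
    then have "a n \<bullet> v n = a n \<bullet> z n" "a n \<bullet> w n = a n \<bullet> z n" using t0 t1 by auto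
    ultimately show ?thesis
      using tn \<delta> u1[of n] by (auto simp: zt u_def inner_diff_right)
  qed
  have near: "\<forall>\<^sub>F n in sequentially. dist (v (r n)) x < \<delta>" using vr \<delta> by (rule tendstoD)
  have lim_le: "b \<bullet> x \<le> b \<bullet> p" if "p \<in> closure X" for p
  proof (rule tendsto_le[OF trivial_limit_sequentially])
    show "(\<lambda>n. a (r n) \<bullet> p) \<longlonglongrightarrow> b \<bullet> p" by (intro tendsto_intros b)
    show "(\<lambda>n. a (r n) \<bullet> v (r n)) \<longlonglongrightarrow> b \<bullet> x" by (intro tendsto_intros b vr)
    show "\<forall>\<^sub>F n in sequentially. a (r n) \<bullet> v (r n) \<le> a (r n) \<bullet> p"
      using near by eventually_elim (use far asup[OF that] in force)
  qed
  have bd: "b \<bullet> d = 0"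
  proof (rule LIMSEQ_unique)
    show "(\<lambda>n. a (r n) \<bullet> u (r n)) \<longlonglongrightarrow> b \<bullet> d" by (intro tendsto_intros b)
    show "(\<lambda>n. a (r n) \<bullet> u (r n)) \<longlonglongrightarrow> 0"
      by (rule tendsto_eventually) (use near far in \<open>force elim: eventually_mono\<close>)
  qed
  have xd: "x + \<delta> *\<^sub>R d \<in> closure X"
    by (rule Lim_in_closed_set[OF closed_closure _ trivial_limit_sequentially qr])
       (use near far in \<open>force elim: eventually_mono\<close>)
  have "(\<lambda>n. b \<bullet> a (r n)) \<longlonglongrightarrow> b \<bullet> b" "(\<lambda>n. d \<bullet> u (r n)) \<longlonglongrightarrow> d \<bullet> d" by (intro tendsto_intros b)+
  then have ev: "\<forall>\<^sub>F n in sequentially. 1/2 < b \<bullet> a (r n)" "\<forall>\<^sub>F n in sequentially. 1/2 < d \<bullet> u (r n)"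
    using b(1,2) by (auto simp only: norm_eq_1 intro!: order_tendstoD(1)[of _ 1 _ "1/2"])
  have "(\<lambda>n. norm (v (r n) - x) + norm (q (r n) - (x + \<delta> *\<^sub>R d))) \<longlonglongrightarrow>
                       norm (x - x) + norm (x + \<delta> *\<^sub>R d - (x + \<delta> *\<^sub>R d))"
    by (intro tendsto_intros vr qr)
  then have ev3: "\<forall>\<^sub>F n in sequentially. norm (v (r n) - x) + norm (q (r n) - (x + \<delta> *\<^sub>R d)) < \<delta> / 8"
    by (rule order_tendstoD(2)) (use \<delta> in simp)
  obtain n where n: "dist (v (r n)) x < \<delta>" "1/2 < b \<bullet> a (r n)" "1/2 < d \<bullet> u (r n)"
     "norm (v (r n) - x) + norm (q (r n) - (x + \<delta> *\<^sub>R d)) < \<delta> / 8"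
    using eventually_happens[OF eventually_conj[OF near eventually_conj[OF ev(1) eventually_conj[OF ev(2) ev3]]]]
    by auto
  define k where "k = r n"
  note n = n[folded k_def]
  note fk = far[OF n(1)]
  have inX: "x \<in> closure X" using x closure_subset by blast
  have "a k \<bullet> q k = a k \<bullet> z k" using fk by (simp add: q_def inner_add_right)
  then have chord': "a k \<bullet> (q k - (x + \<delta> *\<^sub>R d)) \<le> 0"
    using asup[OF xd, of k] by (simp add: inner_diff_right)
  have shift: "q k - (x + \<delta> *\<^sub>R d) = (v k - x) + \<delta> *\<^sub>R (u k - d)"
    by (simp add: q_def algebra_simps)
  have above: "0 \<le> b \<bullet> (v k - x)" "0 \<le> b \<bullet> (q k - (x + \<delta> *\<^sub>R d))"
    using lim_le[OF vX[of k]] lim_le[of "q k"] fk bd by (auto simp: inner_diff_right inner_add_right)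
  have below: "a k \<bullet> (v k - x) \<le> 0"
    using asup[OF inX, of k] fk by (simp add: inner_diff_right)
  have "a k \<bullet> u k = 0" using fk by simp
  note rigid = boundary_chord_rigid[OF b(1,2) a1 u1 bd this \<delta> shift above below chord' less_imp_le[OF n(2)]
      less_imp_le[OF n(3)] n(4)]
  have line: "v k - x = (d \<bullet> (v k - x)) *\<^sub>R d" "u k = (d \<bullet> u k) *\<^sub>R d"
    using orthonormal_expand_2[OF b(1,2) bd, of "v k - x"]
      orthonormal_expand_2[OF b(1,2) bd, of "u k"] rigid by simp_all
  obtain \<alpha> where \<alpha>: "v k = x + \<alpha> *\<^sub>R d"
  proof
    show "v k = x + (d \<bullet> (v k - x)) *\<^sub>R d" using line(1) by (simp only: diff_eq_eq add.commute)
  qed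
  obtain \<beta> where \<beta>: "u k = \<beta> *\<^sub>R d" using line(2) by blast
  obtain N where "w k = v k + N *\<^sub>R u k" using wu[of k] by blast
  then have \<mu>: "w k = x + (\<alpha> + N * \<beta>) *\<^sub>R d" by (simp add: \<alpha> \<beta> algebra_simps)
  have "dist (z k) x \<le> dist (v k) x"
    using missing_point_on_line_near[OF X x, of "\<alpha> + N * \<beta>" d "z k" \<alpha>] w[of k] zX(2)[of k]
    unfolding \<alpha> \<mu> by blast
  then show False using zv(3)[of k] n(1) \<epsilon> by (simp add: \<delta>_def)
qed

section \<open>Convex subsets of the plane\<close>

theorem theorem1:
  fixes X :: "(real ^ 2) set"
  assumes "convex X"
  shows "compactly_convex X"
proof (rule compactly_convexI_graph[OF assms])
  show "subcontinuous_graph (priority_graph X) X"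
    by (rule subcontinuous_priority_graph[OF assms planar_escape_pairs_near[OF assms]])
qed (rule priority_graph_covers)

end
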